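(* Let $n\ge 1$, let $A$ be a nonzero real symmetric $n\times n$ matrix with rank $r(A)$, let $\underline{\boldsymbol{x}}\sim N(\underline 0,I_n)$ and $\boldsymbol{\Delta}=\underline{\boldsymbol{x}}^{\mathsf T}A\underline{\boldsymbol{x}}-\mathrm{tr}(A)$. Let $m\ge 1$ be an integer and $0<b<1$. Then for every $t>0$, $$\Pr(\boldsymbol{\Delta}>t)\le e^{\Lambda_m(t,b)},$$ where $$\Lambda_m(t,b)=\frac{r(A)}{2}\sum_{k=2}^m\frac{b^k}{k}-\kappa_m(b)\min\Big\{\frac{t^{1+\frac1m}}{\|A\|_{m+1}^{1+\frac1m}},\frac{t}{\|A\|}\Big\},$$ $$\kappa_m(b)=\frac{m}{2(m+1)}\min\Big\{\frac{1}{\big((m+1)\theta_m(b)\big)^{\frac1m}},\,b\Big\},$$ and $$\theta_m(b)=-\frac{1}{b^{m+1}}\Big(\ln(1-b)+b+\frac{b^2}{2}+\cdots+\frac{b^m}{m}\Big).$$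
   Context: For a real symmetric $n\times n$ matrix $A$ with eigenvalues $\lambda_1,\dots,\lambda_n$: $\|A\|=\max_i|\lambda_i|$ is the operator norm and $\|A\|_p=(\sum_{i=1}^n|\lambda_i|^p)^{1/p}$ is the Schatten $p$-norm, $p\ge1$. An empty sum (the case $m=1$ of $\sum_{k=2}^m$) is $0$. *)

theory Defs
  imports "HOL-Probability.Probability" "HOL-Computational_Algebra.Polynomial"
begin

definition charpoly :: "real^'n^'n \<Rightarrow> real poly" where
  "charpoly A = det (mat [:0, 1:] - map_matrix (\<lambda>a. [:a:]) A)"

(* Real eigenvalues with algebraic multiplicity; for a symmetric matrix these are
   all CARD('n) eigenvalues, since its characteristic polynomial splits over the reals. *)
definition eigenvalues :: "real^'n^'n \<Rightarrow> real multiset" where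
  "eigenvalues A = proots (charpoly A)"

(* This and schatten_norm are the norms only for symmetric A. *)
definition operator_norm :: "real^'n^'n \<Rightarrow> real" where
  "operator_norm A = Max ((\<lambda>l. \<bar>l\<bar>) ` set_mset (eigenvalues A))"

definition schatten_norm :: "real \<Rightarrow> real^'n^'n \<Rightarrow> real" where
  "schatten_norm p A = (\<Sum>l\<in>#eigenvalues A. \<bar>l\<bar> powr p) powr (1 / p)"

(* Lebesgue density of N(0, I_n), n = CARD('n). *)
definition std_normal_vec_density :: "real^'n \<Rightarrow> real" where
  "std_normal_vec_density x = exp (- (x \<bullet> x) / 2) / sqrt ((2 * pi) ^ CARD('n))"

definition std_normal_vec :: "'a measure \<Rightarrow> ('a \<Rightarrow> real^'n) \<Rightarrow> bool" where
  "std_normal_vec M X \<longleftrightarrow>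
     distributed M lborel X (\<lambda>x. ennreal (std_normal_vec_density x))"

definition theta :: "nat \<Rightarrow> real \<Rightarrow> real" where
  "theta m b = - (1 / b ^ (m + 1)) * (ln (1 - b) + (\<Sum>k=1..m. b ^ k / real k))"

definition kappa :: "nat \<Rightarrow> real \<Rightarrow> real" where
  "kappa m b = real m / (2 * (real m + 1)) *
     min (1 / (((real m + 1) * theta m b) powr (1 / real m))) b"

definition Lambda :: "real^'n^'n \<Rightarrow> nat \<Rightarrow> real \<Rightarrow> real \<Rightarrow> real" where
  "Lambda A m t b =
     real (rank A) / 2 * (\<Sum>k=2..m. b ^ k / real k)
     - kappa m b *
       min (t powr (1 + 1 / real m) / schatten_norm (real m + 1) A powr (1 + 1 / real m))
           (t / operator_norm A)"

end

theory Submission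
  imports Defs
begin

text \<open>
  Write \<open>\<lambda>\<^sub>i\<close> for the eigenvalues of \<open>A\<close>. The standard normal law is invariant under rotations, so
  after diagonalising \<open>A\<close> the variable \<open>\<Delta>\<close> is distributed as the sum of \<open>\<lambda>\<^sub>i (z\<^sub>i\<^sup>2 - 1)\<close> with
  independent standard normal \<open>z\<^sub>i\<close>. For \<open>s > 0\<close> with all \<open>y\<^sub>i = s \<lambda>\<^sub>i < 1\<close> this gives
  (\<open>gaussian_quadratic_form_mgf\<close>)

    \<open>ln E exp (s \<Delta> / 2) = 1/2 \<Sum>\<^sub>i (- ln (1 - y\<^sub>i) - y\<^sub>i)\<close>.

  The summand is the series of \<open>y\<^sub>i ^ k / k\<close> over \<open>k \<ge> 2\<close>. If \<open>s\<close> is so small that every \<open>y\<^sub>i\<close> is at most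
  \<open>b\<close> in absolute value, the terms with \<open>k \<le> m\<close> are at most \<open>b ^ k / k\<close>, and the remaining ones add
  up to at most \<open>\<theta> \<bar>y\<^sub>i\<bar> ^ (m + 1)\<close>, where \<open>\<theta>\<close> is the remainder of the same series at \<open>b\<close>, rescaled
  (\<open>neg_ln_one_minus_minus_le\<close>). Zero eigenvalues contribute nothing, so summation over \<open>i\<close> produces
  the rank in front of the first part and the power \<open>W\<close> of the Schatten norm in the second:

    \<open>ln E exp (s \<Delta> / 2) \<le> 1/2 (r \<Sum>\<^sub>k b ^ k / k + \<theta> s ^ (m + 1) W)\<close>.

  By the exponential Markov inequality (\<open>chernoff_density\<close>) the logarithm of the tail probability is
  at most this bound minus \<open>s t / 2\<close>. Minimising over \<open>s\<close>, subject to \<open>s \<parallel>A\<parallel> \<le> b\<close>, gives the claim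
  (\<open>exponent_choice\<close>): the two alternatives in the minimum of the exponent are the unconstrained
  minimiser and the boundary of the constraint.

  Two classical facts are proved along the way: the spectral theorem for real symmetric matrices
  (\<open>symmetric_matrix_diagonalizable\<close>), by maximising the Rayleigh quotient, and the invariance of
  Lebesgue measure under orthogonal maps (\<open>lborel_distr_orthogonal\<close>), by a Fubini argument.
\<close>

section \<open>Diagonalisation of symmetric matrices\<close>

text \<open>
  The eigenvector is a maximiser of the Rayleigh quotient: on the compact unit sphere of \<open>S\<close>
  the quadratic form \<open>y \<bullet> f y\<close> attains a maximum \<open>\<mu>\<close> at some \<open>x\<close>. Then
  \<open>\<mu> (w \<bullet> w) - w \<bullet> f w\<close> is a nonnegative quadratic form on \<open>S\<close> that vanishes at \<open>x\<close>, so its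
  derivative at \<open>x\<close> vanishes in every direction, in particular in the direction of the residual
  \<open>\<mu> x - f x\<close>; this forces the residual to be zero.
\<close>

lemma self_adjoint_has_unit_eigenvector:
  fixes f :: "'a::euclidean_space \<Rightarrow> 'a"
  assumes lin: "linear f" and sa: "\<And>x y. f x \<bullet> y = x \<bullet> f y"
    and S: "subspace S" "f ` S \<subseteq> S" "S \<noteq> {0}"
  obtains x \<mu> where "x \<in> S" "norm x = 1" "f x = \<mu> *\<^sub>R x"
proof -
  let ?K = "sphere 0 1 \<inter> S"
  have compK: "compact ?K"
    using S(1) by (intro compact_Int_closed closed_subspace) auto
  have neK: "?K \<noteq> {}"
  proof -
    obtain y where y: "y \<in> S" "y \<noteq> 0"
      using S(1,3) subspace_0 by blast
    then have "y /\<^sub>R norm y \<in> ?K"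
      using S(1) by (auto simp: subspace_scale)
    then show ?thesis by blast
  qed
  have cont: "continuous_on ?K (\<lambda>x. x \<bullet> f x)"
    using lin by (intro continuous_on_inner continuous_on_id linear_continuous_on)
      (simp add: linear_conv_bounded_linear)
  obtain x where x: "x \<in> S" "norm x = 1" and max: "\<And>y. y \<in> ?K \<Longrightarrow> y \<bullet> f y \<le> x \<bullet> f x"
    using continuous_attains_sup[OF compK neK cont] by auto
  define \<mu> where "\<mu> = x \<bullet> f x"
  define g where "g w = \<mu> * (w \<bullet> w) - w \<bullet> f w" for w
  have g_nonneg: "g w \<ge> 0" if "w \<in> S" for w
  proof (cases "w = 0")
    case True
    then show ?thesis by (simp add: g_def linear_0 lin)
  next
    case False
    have "w /\<^sub>R norm w \<in> ?K"
      using False that S(1) by (auto simp: subspace_scale)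
    from max[OF this] have "(w \<bullet> f w) / (norm w)\<^sup>2 \<le> \<mu>"
      by (simp add: \<mu>_def linear_scale lin power2_eq_square divide_simps)
    then show ?thesis
      using False by (simp add: g_def power2_norm_eq_inner divide_simps)
  qed
  define r where "r = \<mu> *\<^sub>R x - f x"
  have rS: "r \<in> S"
    unfolding r_def using S x by (auto intro!: subspace_diff subspace_scale)
  have quad: "0 \<le> s\<^sup>2 * g r + 2 * s * (r \<bullet> r)" for s
  proof -
    have "x + s *\<^sub>R r \<in> S"
      using S(1) x rS by (simp add: subspace_add subspace_scale)
    from g_nonneg[OF this] have "0 \<le> g (x + s *\<^sub>R r)" .
    also have "g (x + s *\<^sub>R r) = g x + s\<^sup>2 * g r + 2 * s * (\<mu> * (x \<bullet> r) - f x \<bullet> r)"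
      by (simp add: g_def linear_add linear_scale lin inner_add_left inner_add_right sa[of x r]
          inner_commute[of r x] inner_commute[of r "f x"] power2_eq_square algebra_simps)
    also have "g x = 0"
      using x by (simp add: g_def \<mu>_def norm_eq_1)
    also have "\<mu> * (x \<bullet> r) - f x \<bullet> r = r \<bullet> r"
      by (simp add: r_def inner_diff_left)
    finally show ?thesis by simp
  qed
  have "r \<bullet> r = 0"
  proof (rule ccontr)
    assume "r \<bullet> r \<noteq> 0"
    then have pos: "r \<bullet> r > 0" by simp
    \<comment> \<open>Near the minimiser of the quadratic; the summand 1 keeps the denominator positive when \<open>g r = 0\<close>.\<close>
    define s where "s = - (r \<bullet> r) / (g r + 1)"
    have gr: "g r + 1 > 0" using g_nonneg[OF rS] by simp
    have "s\<^sup>2 * g r + 2 * s * (r \<bullet> r) \<le> s\<^sup>2 * (g r + 1) + 2 * s * (r \<bullet> r)"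
      by (simp add: algebra_simps)
    also have "\<dots> = s * (s * (g r + 1)) + 2 * s * (r \<bullet> r)"
      by (simp add: power2_eq_square)
    also have "s * (g r + 1) = - (r \<bullet> r)"
      using gr by (simp add: s_def)
    also have "s * - (r \<bullet> r) + 2 * s * (r \<bullet> r) = s * (r \<bullet> r)"
      by simp
    also have "\<dots> < 0"
      using gr pos by (simp add: s_def divide_neg_pos mult_neg_pos)
    finally show False using quad[of s] by simp
  qed
  then have "f x = \<mu> *\<^sub>R x" by (simp add: r_def)
  then show ?thesis using that x by blast
qed

text \<open>
  Induction on the dimension: the orthogonal complement in \<open>S\<close> of an eigenvector is again
  invariant, because \<open>x \<bullet> f y = f x \<bullet> y = \<mu> (x \<bullet> y)\<close>. Working with invariant subspaces of one fixed
  space, and not with smaller matrices, is what makes an induction possible when the dimension is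
  a type.
\<close>

lemma self_adjoint_orthonormal_eigenbasis:
  fixes f :: "'a::euclidean_space \<Rightarrow> 'a"
  assumes lin: "linear f" and sa: "\<And>x y. f x \<bullet> y = x \<bullet> f y"
    and "subspace S" "f ` S \<subseteq> S"
  shows "\<exists>B\<subseteq>S. pairwise orthogonal B \<and> (\<forall>x\<in>B. norm x = 1 \<and> (\<exists>\<mu>. f x = \<mu> *\<^sub>R x)) \<and> span B = S"
  using assms(3,4)
proof (induction "dim S" arbitrary: S rule: less_induct)
  case less
  show ?case
  proof (cases "S = {0}")
    case True
    then show ?thesis by (intro exI[of _ "{}"]) auto
  next
    case False
    then obtain x \<mu> where x: "x \<in> S" "norm x = 1" "f x = \<mu> *\<^sub>R x"
      using self_adjoint_has_unit_eigenvector[OF lin sa less.prems] by blast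
    define T where "T = {y \<in> S. x \<bullet> y = 0}"
    have T: "subspace T"
      using less.prems(1) by (auto simp: T_def subspace_def inner_add_right)
    have fT: "f ` T \<subseteq> T"
      using less.prems(2) x(3) by (auto simp: T_def sa[symmetric])
    have "x \<notin> T" using x(2) by (simp add: T_def norm_eq_1)
    have "T \<subseteq> S" by (auto simp: T_def)
    with \<open>x \<notin> T\<close> x(1) have "T \<subset> S" by blast
    moreover have "span T = T" "span S = S"
      using T less.prems(1) by simp_all
    ultimately have "span T \<subset> span S" by (simp only:)
    then have "dim T < dim S" by (rule dim_psubset)
    from less.hyps[OF this T fT] obtain B where
      B: "B \<subseteq> T" "pairwise orthogonal B" "\<forall>x\<in>B. norm x = 1 \<and> (\<exists>\<mu>. f x = \<mu> *\<^sub>R x)" "span B = T"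
      by blast
    have "span (insert x B) = S"
    proof
      show "span (insert x B) \<subseteq> S"
        using B(1) x(1) less.prems(1) \<open>T \<subseteq> S\<close> by (intro span_minimal) blast+
      show "S \<subseteq> span (insert x B)"
      proof
        fix y assume "y \<in> S"
        then have "y - (x \<bullet> y) *\<^sub>R x \<in> T"
          using less.prems(1) x by (auto simp: T_def subspace_diff subspace_scale inner_diff_right norm_eq_1)
        then have "y - (x \<bullet> y) *\<^sub>R x \<in> span B" by (simp add: B(4))
        then show "y \<in> span (insert x B)"
          unfolding span_insert by blast
      qed
    qed
    moreover have "x \<bullet> y = 0" "y \<bullet> x = 0" if "y \<in> B" for y
      using that B(1) by (auto simp: T_def inner_commute)
    then have "pairwise orthogonal (insert x B)"
      using B(2) by (simp add: pairwise_insert orthogonal_def)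
    moreover have "insert x B \<subseteq> S"
      using B(1) x(1) \<open>T \<subseteq> S\<close> by blast
    moreover have "\<forall>y\<in>insert x B. norm y = 1 \<and> (\<exists>\<mu>. f y = \<mu> *\<^sub>R y)"
      using B(3) x(2,3) by blast
    ultimately show ?thesis by blast
  qed
qed

definition diag :: "('n \<Rightarrow> 'a::zero) \<Rightarrow> 'a^'n^'n" where
  "diag d = (\<chi> i j. if i = j then d i else 0)"

lemma diag_mult_vec: "(diag d *v x) $ i = d i * x $ i" for x :: "'a::semiring_1^'n"
  by (simp add: diag_def matrix_vector_mult_def mult_delta_left)

text \<open>
  The columns of \<open>Q\<close> are an orthonormal eigenbasis of \<open>A\<close>, enumerated by the index type; this is
  possible since such a basis has \<open>CARD('n)\<close> elements.
\<close>

lemma symmetric_matrix_diagonalizable: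
  fixes A :: "real^'n^'n"
  assumes sym: "transpose A = A"
  obtains Q d where "orthogonal_matrix Q" "A = Q ** diag d ** transpose Q"
proof -
  have sa: "(A *v x) \<bullet> y = x \<bullet> (A *v y)" for x y
    by (metis dot_lmul_matrix sym vector_transpose_matrix)
  obtain B where B: "pairwise orthogonal B" "\<And>x. x \<in> B \<Longrightarrow> norm x = 1"
      "\<And>x. x \<in> B \<Longrightarrow> \<exists>\<mu>. A *v x = \<mu> *\<^sub>R x" "span B = (UNIV :: (real^'n) set)"
  proof -
    have "\<exists>B\<subseteq>UNIV. pairwise orthogonal B \<and> (\<forall>x\<in>B. norm x = 1 \<and> (\<exists>\<mu>. A *v x = \<mu> *\<^sub>R x)) \<and> span B = UNIV"
      by (rule self_adjoint_orthonormal_eigenbasis) (simp_all add: sa)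
    then show ?thesis using that by blast
  qed
  have indep: "independent B"
    using B(1,2) by (intro pairwise_orthogonal_independent) force+
  have "card B = CARD('n)"
    using dim_span_eq_card_independent[OF indep] B(4) by simp
  then obtain v :: "'n \<Rightarrow> real^'n" where v: "bij_betw v UNIV B"
    using indep by (metis finite finite_same_card_bij independent_imp_finite)
  then have vB: "v i \<in> B" for i by (auto simp: bij_betw_def)
  obtain d where d: "A *v v i = d i *\<^sub>R v i" for i
    using B(3)[OF vB] by metis
  define Q :: "real^'n^'n" where "Q = (\<chi> i j. v j $ i)"
  have colQ: "column j Q = v j" for j
    by (simp add: Q_def column_def vec_eq_iff)
  have "v i \<noteq> v j" if "i \<noteq> j" for i j
    using v that by (auto simp: bij_betw_def inj_on_def)
  then have orth: "orthogonal_matrix Q"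
    unfolding orthogonal_matrix_orthonormal_columns colQ
    using B(1,2) vB by (auto simp: pairwise_def)
  have "A ** Q = Q ** diag d"
  proof -
    have "(A ** Q) $ i $ j = (A *v v j) $ i" for i j
      by (simp add: matrix_matrix_mult_def matrix_vector_mult_def Q_def)
    moreover have "(Q ** diag d) $ i $ j = (d j *\<^sub>R v j) $ i" for i j
      by (simp add: matrix_matrix_mult_def diag_def Q_def mult_delta_right)
    ultimately show ?thesis by (simp add: vec_eq_iff d)
  qed
  then have "A = Q ** diag d ** transpose Q"
    using orth by (metis matrix_mul_assoc matrix_mul_rid orthogonal_matrix_def)
  then show ?thesis using that orth by blast
qed

section \<open>Eigenvalues, trace and rank of a diagonalised matrix\<close>

text \<open>
  The characteristic polynomial is invariant under conjugation: over the polynomial ring,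
  \<open>X I - Q D Q\<^sup>T\<close> equals \<open>Q (X I - D) Q\<^sup>T\<close>, since scalar matrices commute with everything, and the
  determinants of the two outer factors cancel. What remains is the product of the factors
  \<open>X - d\<^sub>i\<close>, whose roots with multiplicity can be read off.
\<close>

lemma eigenvalues_orthogonal_diag:
  fixes Q :: "real^'n^'n"
  assumes Q: "orthogonal_matrix Q"
  shows "eigenvalues (Q ** diag d ** transpose Q) = image_mset d (mset_set UNIV)"
proof -
  define C :: "real^'n^'n \<Rightarrow> real poly^'n^'n" where "C = map_matrix (\<lambda>a. [:a:])"
  let ?X = "mat [:0, 1:] :: real poly^'n^'n"
  have C_sum: "(\<Sum>x\<in>S. [:f x:]) = [:sum f S:]" for f :: "'n \<Rightarrow> real" and S
    by (induction S rule: infinite_finite_induct) auto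
  have C_mult: "C (M ** N) = C M ** C N" for M N
    by (simp add: C_def vec_eq_iff matrix_matrix_mult_def C_sum mult.commute)
  have C_one: "C (mat 1) = mat 1"
    by (simp add: C_def vec_eq_iff mat_def)
  have X_comm: "?X ** M = M ** ?X" for M
    by (simp add: vec_eq_iff matrix_matrix_mult_def mat_def mult_delta_left mult_delta_right mult.commute)
  have diff_distrib: "N ** (M - M') = N ** M - N ** M'" "(M - M') ** N = M ** N - M' ** N"
    for M M' N :: "real poly^'n^'n"
    by (simp_all add: vec_eq_iff matrix_matrix_mult_def sum_subtractf algebra_simps)
  have QQ: "Q ** transpose Q = mat 1"
    using Q by (simp add: orthogonal_matrix_def)
  have "C Q ** ?X ** C (transpose Q) = ?X"
    by (simp add: X_comm[symmetric] matrix_mul_assoc[symmetric] C_mult[symmetric] QQ C_one)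
  then have "?X - C (Q ** diag d ** transpose Q) = C Q ** (?X - C (diag d)) ** C (transpose Q)"
    by (simp add: diff_distrib C_mult)
  then have "charpoly (Q ** diag d ** transpose Q) = det (C Q ** (?X - C (diag d)) ** C (transpose Q))"
    by (simp add: charpoly_def C_def)
  also have "\<dots> = det (C Q ** C (transpose Q)) * det (?X - C (diag d))"
    by (simp add: det_mul)
  also have "det (C Q ** C (transpose Q)) = 1"
    by (simp add: C_mult[symmetric] QQ C_one)
  also have "det (?X - C (diag d)) = (\<Prod>i\<in>UNIV. [:- d i, 1:])"
    by (subst det_diagonal) (auto simp: mat_def C_def diag_def)
  finally have "eigenvalues (Q ** diag d ** transpose Q) = (\<Sum>i\<in>UNIV. {#d i#})"
    by (simp add: eigenvalues_def proots_prod)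
  also have "\<dots> = image_mset d (mset_set UNIV)"
    by (simp add: sum_unfold_sum_mset)
  finally show ?thesis .
qed

lemma orthogonal_transformation_mult_vec:
  fixes Q :: "real^'n^'n"
  assumes "orthogonal_matrix Q"
  shows "orthogonal_transformation ((*v) Q)"
  using assms by (simp add: orthogonal_transformation_matrix)

lemma trace_orthogonal_diag:
  fixes Q :: "real^'n^'n"
  assumes "orthogonal_matrix Q"
  shows "trace (Q ** diag d ** transpose Q) = (\<Sum>i\<in>UNIV. d i)"
proof -
  have "trace (Q ** diag d ** transpose Q) = trace (transpose Q ** Q ** diag d)"
    by (metis matrix_mul_assoc trace_mul_sym)
  also have "\<dots> = trace (diag d)"
    using assms by (simp add: orthogonal_matrix_def)
  finally show ?thesis by (simp add: trace_def diag_def)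
qed

lemma quadratic_form_orthogonal_diag:
  fixes Q :: "real^'n^'n"
  assumes Q: "orthogonal_matrix Q"
  shows "(Q *v x) \<bullet> ((Q ** diag d ** transpose Q) *v (Q *v x)) = (\<Sum>i\<in>UNIV. d i * (x $ i)\<^sup>2)"
proof -
  have "(Q ** diag d ** transpose Q) ** Q = Q ** diag d"
    using Q by (simp add: orthogonal_matrix_def flip: matrix_mul_assoc)
  then have "(Q ** diag d ** transpose Q) *v (Q *v x) = Q *v (diag d *v x)"
    by (simp only: matrix_vector_mul_assoc)
  then have "(Q *v x) \<bullet> ((Q ** diag d ** transpose Q) *v (Q *v x)) = x \<bullet> (diag d *v x)"
    using orthogonal_transformation_mult_vec[OF Q] by (simp add: orthogonal_transformation_def)
  then show ?thesis
    by (simp add: inner_vec_def diag_mult_vec power2_eq_square mult_ac)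
qed

text \<open>
  The rank bounds the number of eigenvalues that contribute to the logarithm of the moment
  generating function. The range of \<open>diag d\<close> contains the unit vectors belonging to the nonzero
  \<open>d i\<close>, and multiplication by \<open>Q\<close> and its transpose does not raise the rank.
\<close>

lemma card_nonzero_le_rank_orthogonal_diag:
  fixes Q :: "real^'n^'n"
  assumes Q: "orthogonal_matrix Q"
  shows "card {i. d i \<noteq> 0} \<le> rank (Q ** diag d ** transpose Q)"
proof -
  let ?A = "Q ** diag d ** transpose Q"
  let ?e = "\<lambda>i. axis i 1 :: real^'n"
  have "?e i \<in> range ((*v) (diag d))" if "d i \<noteq> 0" for i
  proof -
    have "diag d *v axis i (1 / d i) = ?e i"
      using that by (simp add: vec_eq_iff diag_mult_vec axis_def)
    then show ?thesis by (metis rangeI)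
  qed
  then have sub: "?e ` {i. d i \<noteq> 0} \<subseteq> range ((*v) (diag d))" by blast
  have "?e ` {i. d i \<noteq> 0} \<subseteq> Basis"
    by (auto simp: axis_in_Basis_iff)
  then have indep: "independent (?e ` {i. d i \<noteq> 0})"
    using independent_Basis independent_mono by blast
  have "card {i. d i \<noteq> 0} = card (?e ` {i. d i \<noteq> 0})"
    by (rule card_image[symmetric]) (auto simp: inj_on_def axis_eq_axis)
  also have "\<dots> \<le> rank (diag d)"
    using dim_subset[OF sub] dim_eq_card_independent[OF indep] by (simp add: rank_dim_range)
  also have "diag d = transpose Q ** ?A ** Q"
    using Q by (metis matrix_mul_assoc matrix_mul_lid matrix_mul_rid orthogonal_matrix_def)
  also have "rank (transpose Q ** ?A ** Q) \<le> rank ?A"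
    by (meson order_trans rank_mul_le_left rank_mul_le_right)
  finally show ?thesis .
qed

section \<open>Rotation invariance of Lebesgue measure\<close>

text \<open>
  The usual uniqueness argument for translation-invariant measures, for Lebesgue measure \<open>\<mu>\<close> and its
  image under \<open>f\<close>. With \<open>U\<close> the unit ball, the product of \<open>\<mu> U\<close> and the image measure of \<open>B\<close> is the
  integral of \<open>1\<^sub>U(x) 1\<^sub>B(f y)\<close> over all \<open>(x, y)\<close>. Shifting \<open>y\<close> by the preimage of \<open>x\<close> and then \<open>x\<close> by \<open>- f y\<close>
  turns the integrand into \<open>1\<^sub>U(x - f y) 1\<^sub>B(x)\<close>. As \<open>f\<close> is an isometry, the integral over \<open>y\<close> is
  now the volume of a unit ball, so the product is also \<open>\<mu> U \<cdot> \<mu> B\<close>, and \<open>\<mu> U\<close> cancels.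
\<close>

lemma lborel_distr_orthogonal:
  fixes f :: "'a::euclidean_space \<Rightarrow> 'a"
  assumes f: "orthogonal_transformation f"
  shows "distr lborel borel f = lborel"
proof (rule measure_eqI)
  show "sets (distr lborel borel f) = sets (lborel :: 'a measure)" by simp
  fix B assume "B \<in> sets (distr lborel borel f)"
  then have B[measurable]: "B \<in> sets borel" by simp
  have lin: "linear f" using f by (rule orthogonal_transformation_linear)
  have fm[measurable]: "f \<in> borel_measurable borel"
    using lin by (intro borel_measurable_continuous_onI linear_continuous_on) (simp add: linear_conv_bounded_linear)
  define U where "U = ball (0::'a) 1"
  have U[measurable]: "U \<in> sets borel" by (simp add: U_def)
  define V :: ennreal where "V = emeasure lborel U"
  have shift: "(\<integral>\<^sup>+y. h (y + c) \<partial>lborel) = (\<integral>\<^sup>+y. h y \<partial>lborel)"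
    if [measurable]: "h \<in> borel_measurable borel" for h :: "'a \<Rightarrow> ennreal" and c
    by (subst lborel_distr_plus[symmetric, of c], subst nn_integral_distr) (auto simp: add.commute)
  have "V * emeasure (distr lborel borel f) B
      = (\<integral>\<^sup>+x. indicator U x * (\<integral>\<^sup>+y. indicator B (f y) \<partial>lborel) \<partial>lborel)"
  proof -
    have "emeasure (distr lborel borel f) B = (\<integral>\<^sup>+y. indicator B (f y) \<partial>lborel)"
      using nn_integral_distr[of f lborel borel "indicator B"] by simp
    then show ?thesis
      by (subst nn_integral_multc) (simp_all add: V_def borel_measurable_indicator)
  qed
  also have "\<dots> = (\<integral>\<^sup>+x. \<integral>\<^sup>+y. indicator U x * indicator B (f y + x) \<partial>lborel \<partial>lborel)"
  proof (rule nn_integral_cong)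
    fix x :: 'a
    obtain z where z: "f z = x"
      using orthogonal_transformation_surj[OF f] by (metis surjD)
    have "(\<integral>\<^sup>+y. indicator B (f y) \<partial>lborel) = (\<integral>\<^sup>+y. indicator B (f (y + z)) \<partial>lborel)"
      by (rule shift[symmetric]) simp
    then show "indicator U x * (\<integral>\<^sup>+y. indicator B (f y) \<partial>lborel) =
        (\<integral>\<^sup>+y. indicator U x * indicator B (f y + x) \<partial>lborel)"
      by (simp add: nn_integral_cmult linear_add[OF lin] z)
  qed
  also have "\<dots> = (\<integral>\<^sup>+y. \<integral>\<^sup>+x. indicator U x * indicator B (f y + x) \<partial>lborel \<partial>lborel)"
    by (rule lborel_pair.Fubini') simp
  also have "\<dots> = (\<integral>\<^sup>+y. \<integral>\<^sup>+x. indicator U (x - f y) * indicator B x \<partial>lborel \<partial>lborel)"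
  proof (rule nn_integral_cong)
    fix y
    show "(\<integral>\<^sup>+x. indicator U x * indicator B (f y + x) \<partial>lborel) =
        (\<integral>\<^sup>+x. indicator U (x - f y) * indicator B x \<partial>lborel)"
      using shift[of "\<lambda>x. indicator U (x - f y) * indicator B x" "f y"]
      by (simp add: add.commute)
  qed
  also have "\<dots> = (\<integral>\<^sup>+x. \<integral>\<^sup>+y. indicator U (x - f y) * indicator B x \<partial>lborel \<partial>lborel)"
    by (rule lborel_pair.Fubini') simp
  also have "\<dots> = (\<integral>\<^sup>+x. V * indicator B x \<partial>lborel)"
  proof (rule nn_integral_cong)
    fix x :: 'a
    obtain z where z: "f z = x"
      using orthogonal_transformation_surj[OF f] by (metis surjD)
    have "dist (f z) (f y) = dist z y" for y
      using f by (simp add: orthogonal_transformation_isometry)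
    then have eq: "indicator U (x - f y) = (indicator (ball z 1) y :: ennreal)" for y
      by (auto simp: U_def indicator_def z dist_norm norm_minus_commute[of x])
    show "(\<integral>\<^sup>+y. indicator U (x - f y) * indicator B x \<partial>lborel) = V * indicator B x"
    proof -
      have [measurable]: "ball z 1 \<in> sets borel" by simp
      have "(\<lambda>y. indicator (ball z 1) y :: ennreal) \<in> borel_measurable lborel"
        by measurable
      from nn_integral_multc[OF this, of "indicator B x"] show ?thesis
        unfolding eq by (simp add: V_def U_def emeasure_ball)
    qed
  qed
  also have "\<dots> = V * emeasure lborel B" by (simp add: nn_integral_cmult)
  finally have "V * emeasure (distr lborel borel f) B = V * emeasure lborel B" .
  moreover have "V \<noteq> 0" "V \<noteq> \<top>"
    by (auto simp: V_def U_def emeasure_ball unit_ball_vol_pos ennreal_eq_0_iff  not_le)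
  ultimately show "emeasure (distr lborel borel f) B = emeasure lborel B"
    by (simp add: ennreal_mult_cancel_left)
qed

section \<open>The moment generating function of a Gaussian quadratic form\<close>

text \<open>
  Fubini for product functions, with the coordinates indexed by the index type and not by basis
  vectors.
\<close>

lemma nn_integral_lborel_prod_vec:
  fixes g :: "'n::finite \<Rightarrow> real \<Rightarrow> ennreal"
  assumes g: "\<And>i. g i \<in> borel_measurable borel"
  shows "(\<integral>\<^sup>+x. (\<Prod>i\<in>UNIV. g i (x $ i)) \<partial>(lborel :: (real^'n) measure)) = (\<Prod>i\<in>UNIV. \<integral>\<^sup>+z. g i z \<partial>lborel)"
proof -
  have Basis_eq: "(Basis :: (real^'n) set) = range (\<lambda>i. axis i 1)"
    by (auto simp: Basis_vec_def)
  have inj: "inj (\<lambda>i::'n. axis i (1::real))"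
    by (simp add: inj_on_def axis_eq_axis)
  have "(\<integral>\<^sup>+x. (\<Prod>b\<in>Basis. g (axis_index b) (x \<bullet> b)) \<partial>(lborel :: (real^'n) measure))
      = (\<Prod>b\<in>(Basis :: (real^'n) set). \<integral>\<^sup>+z. g (axis_index b) z \<partial>lborel)"
    by (rule nn_integral_lborel_prod) (simp_all add: g)
  then show ?thesis
    by (simp add: Basis_eq prod.reindex[OF inj] inner_axis)
qed

text \<open>
  Combining the exponents shows that the integrand is a constant multiple of the normal density
  with variance \<open>1 / (1 - y)\<close>, which has integral 1.
\<close>

lemma nn_integral_std_normal_exp_square:
  fixes y :: real
  assumes "y < 1"
  shows "(\<integral>\<^sup>+z. ennreal (std_normal_density z * exp (y / 2 * (z\<^sup>2 - 1))) \<partial>lborel)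
    = ennreal (exp (- y / 2) / sqrt (1 - y))"
proof -
  define \<sigma> where "\<sigma> = 1 / sqrt (1 - y)"
  have \<sigma>: "\<sigma> > 0" "\<sigma>\<^sup>2 = 1 / (1 - y)"
    using assms by (auto simp: \<sigma>_def power_divide)
  have "std_normal_density z * exp (y / 2 * (z\<^sup>2 - 1)) = exp (- y / 2) / sqrt (1 - y) * normal_density 0 \<sigma> z" for z
  proof -
    have "- z\<^sup>2 / 2 + y / 2 * (z\<^sup>2 - 1) = - y / 2 + (- (z - 0)\<^sup>2 / (2 * \<sigma>\<^sup>2))"
      unfolding \<sigma>(2) using assms by (simp add: field_simps)
    then have "exp (- z\<^sup>2 / 2) * exp (y / 2 * (z\<^sup>2 - 1)) = exp (- y / 2) * exp (- (z - 0)\<^sup>2 / (2 * \<sigma>\<^sup>2))"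
      by (simp only: exp_add[symmetric])
    moreover have "sqrt (2 * pi * \<sigma>\<^sup>2) = sqrt (2 * pi) / sqrt (1 - y)"
      by (simp add: \<sigma>(2) real_sqrt_divide)
    ultimately show ?thesis
      using assms by (simp add: std_normal_density_def normal_density_def)
  qed
  then have "(\<integral>\<^sup>+z. ennreal (std_normal_density z * exp (y / 2 * (z\<^sup>2 - 1))) \<partial>lborel)
      = (\<integral>\<^sup>+z. ennreal (exp (- y / 2) / sqrt (1 - y)) * ennreal (normal_density 0 \<sigma> z) \<partial>lborel)"
    using assms by (simp add: ennreal_mult'' flip: ennreal_mult'')
  also have "\<dots> = ennreal (exp (- y / 2) / sqrt (1 - y)) * (\<integral>\<^sup>+z. ennreal (normal_density 0 \<sigma> z) \<partial>lborel)"
    by (rule nn_integral_cmult) simp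
  also have "(\<integral>\<^sup>+z. ennreal (normal_density 0 \<sigma> z) \<partial>lborel) = 1"
    using \<sigma>(1) by (simp add: nn_integral_eq_integral)
  finally show ?thesis by simp
qed

lemma std_normal_vec_density_eq_prod:
  "std_normal_vec_density x = (\<Prod>i\<in>UNIV. std_normal_density (x $ i))" for x :: "real^'n"
proof -
  have "(\<Prod>i\<in>UNIV. std_normal_density (x $ i)) = (\<Prod>i\<in>(UNIV :: 'n set). 1 / sqrt (2 * pi)) * exp (\<Sum>i\<in>UNIV. - (x $ i)\<^sup>2 / 2)"
    by (simp add: std_normal_density_def prod.distrib exp_sum prod_dividef del: prod_constant)
  also have "(\<Sum>i\<in>UNIV. - (x $ i)\<^sup>2 / 2) = - (x \<bullet> x) / 2"
    by (simp add: inner_vec_def power2_eq_square sum_negf sum_divide_distrib)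
  finally show ?thesis
    unfolding std_normal_vec_density_def real_sqrt_power by (simp add: power_divide)
qed

text \<open>
  The Gaussian density and Lebesgue measure are both invariant under \<open>Q\<close>, so \<open>x\<close> may be replaced by
  \<open>Q x\<close>. The integrand then splits into a product of functions of single coordinates. The parameter
  is written as \<open>s / 2\<close> because the domain of finiteness becomes \<open>s d\<^sub>i < 1\<close> in this normalisation.
\<close>

lemma gaussian_quadratic_form_mgf:
  fixes Q :: "real^'n^'n"
  assumes Q: "orthogonal_matrix Q" and A: "A = Q ** diag d ** transpose Q"
    and s: "\<And>i. s * d i < 1"
  shows "(\<integral>\<^sup>+x. ennreal (std_normal_vec_density x * exp (s / 2 * (x \<bullet> (A *v x) - trace A))) \<partial>lborel)
    = ennreal (\<Prod>i\<in>UNIV. exp (- (s * d i) / 2) / sqrt (1 - s * d i))"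
proof -
  let ?F = "\<lambda>x. ennreal (std_normal_vec_density x * exp (s / 2 * (x \<bullet> (A *v x) - trace A)))"
  let ?g = "\<lambda>i z. std_normal_density z * exp (s * d i / 2 * (z\<^sup>2 - 1))"
  have orth: "orthogonal_transformation ((*v) Q)"
    using Q by (rule orthogonal_transformation_mult_vec)
  have cont: "continuous_on UNIV ((*v) M)" for M :: "real^'n^'n"
    by (intro linear_continuous_on) (simp add: linear_conv_bounded_linear[symmetric])
  have [measurable]: "(*v) M \<in> borel_measurable borel" for M :: "real^'n^'n"
    by (intro borel_measurable_continuous_onI cont)
  have F_measurable: "?F \<in> borel_measurable borel"
    unfolding std_normal_vec_density_def by measurable
  have rotate: "?F (Q *v x) = (\<Prod>i\<in>UNIV. ennreal (?g i (x $ i)))" for x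
  proof -
    have "s / 2 * ((Q *v x) \<bullet> (A *v (Q *v x)) - trace A) = (\<Sum>i\<in>UNIV. s * d i / 2 * ((x $ i)\<^sup>2 - 1))"
      unfolding A quadratic_form_orthogonal_diag[OF Q] trace_orthogonal_diag[OF Q]
      by (simp add: sum_subtractf[symmetric] sum_distrib_left algebra_simps)
    moreover have "std_normal_vec_density (Q *v x) = std_normal_vec_density x"
      using orth by (simp add: std_normal_vec_density_def orthogonal_transformation_def)
    ultimately show ?thesis
      by (simp add: std_normal_vec_density_eq_prod exp_sum prod.distrib prod_ennreal)
  qed
  have "(\<integral>\<^sup>+x. ?F x \<partial>lborel) = (\<integral>\<^sup>+x. ?F x \<partial>(distr lborel borel ((*v) Q)))"
    by (simp add: lborel_distr_orthogonal[OF orth])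
  also have "\<dots> = (\<integral>\<^sup>+x. ?F (Q *v x) \<partial>lborel)"
  proof (rule nn_integral_distr)
    show "?F \<in> borel_measurable (distr lborel borel ((*v) Q))"
      using F_measurable by (simp only: measurable_distr_eq1)
  qed simp
  also have "\<dots> = (\<Prod>i\<in>UNIV. \<integral>\<^sup>+z. ennreal (?g i z) \<partial>lborel)"
    unfolding rotate by (rule nn_integral_lborel_prod_vec) simp
  also have "\<dots> = (\<Prod>i\<in>UNIV. ennreal (exp (- (s * d i) / 2) / sqrt (1 - s * d i)))"
    by (intro prod.cong nn_integral_std_normal_exp_square s refl)
  also have "\<dots> = ennreal (\<Prod>i\<in>UNIV. exp (- (s * d i) / 2) / sqrt (1 - s * d i))"
    using s by (intro prod_ennreal) (simp add: less_imp_le)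
  finally show ?thesis .
qed

text \<open>
  The exponential Markov inequality, phrased as an integral against the density so that the
  rotation argument applies directly.
\<close>

lemma chernoff_density:
  fixes X :: "'a \<Rightarrow> 'b" and f h :: "'b \<Rightarrow> real"
  assumes X: "distributed M N X (\<lambda>x. ennreal (f x))" and f: "\<And>x. f x \<ge> 0"
    and h[measurable]: "h \<in> borel_measurable N" and u: "u \<ge> 0"
  shows "emeasure M {\<omega> \<in> space M. h (X \<omega>) > t} \<le> ennreal (exp (- u * t)) * (\<integral>\<^sup>+x. ennreal (f x * exp (u * h x)) \<partial>N)"
proof -
  have X_measurable: "X \<in> measurable M N"
    using X by (simp add: distributed_def)
  have [measurable]: "f \<in> borel_measurable N"
    using distributed_real_measurable[OF _ X] f by simp
  let ?S = "{x \<in> space N. h x > t}"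
  have "{\<omega> \<in> space M. h (X \<omega>) > t} = X -` ?S \<inter> space M"
    using measurable_space[OF X_measurable] by auto
  moreover have "emeasure M (X -` ?S \<inter> space M) = (\<integral>\<^sup>+x. ennreal (f x) * indicator ?S x \<partial>N)"
    by (rule distributed_emeasure[OF X]) measurable
  ultimately have "emeasure M {\<omega> \<in> space M. h (X \<omega>) > t} = (\<integral>\<^sup>+x. ennreal (f x) * indicator ?S x \<partial>N)"
    by (simp only:)
  also have "\<dots> \<le> (\<integral>\<^sup>+x. ennreal (exp (- u * t)) * ennreal (f x * exp (u * h x)) \<partial>N)"
  proof (rule nn_integral_mono)
    fix x
    have "f x \<le> exp (- u * t) * (f x * exp (u * h x))" if "h x > t"
    proof -
      have "0 \<le> u * (h x - t)" using u that by simp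
      then have "1 \<le> exp (u * (h x - t))" by simp
      also have "\<dots> = exp (- u * t) * exp (u * h x)"
        by (simp add: exp_add[symmetric] algebra_simps)
      finally show ?thesis
        using mult_left_mono[OF _ f[of x]] by (fastforce simp: mult_ac)
    qed
    then show "ennreal (f x) * indicator ?S x \<le> ennreal (exp (- u * t)) * ennreal (f x * exp (u * h x))"
      using f by (auto simp: indicator_def ennreal_mult'[symmetric] intro!: ennreal_leI)
  qed
  also have "\<dots> = ennreal (exp (- u * t)) * (\<integral>\<^sup>+x. ennreal (f x * exp (u * h x)) \<partial>N)"
    by (rule nn_integral_cmult) measurable
  finally show ?thesis .
qed

section \<open>Estimating the logarithm\<close>

lemma neg_ln_one_minus_sums:
  fixes y :: real
  assumes "\<bar>y\<bar> < 1"
  shows "(\<lambda>n. y ^ n / real n) sums (- ln (1 - y))"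
  using sums_minus[OF ln_series'[of "- y"]] assms by simp

text \<open>
  The \<open>k = 0\<close> term of the logarithm series is \<open>1 / 0 = 0\<close>, so the first \<open>m + 1\<close> terms are
  the sum from 1 to \<open>m\<close>.
\<close>

lemma neg_ln_one_minus_tail_sums:
  fixes y :: real
  assumes "\<bar>y\<bar> < 1"
  shows "(\<lambda>n. y ^ (n + (m + 1)) / real (n + (m + 1))) sums (- ln (1 - y) - (\<Sum>k=1..m. y ^ k / real k))"
proof -
  have "(\<Sum>i<m + 1. y ^ i / real i) = (\<Sum>k=1..m. y ^ k / real k)"
    by (rule sum.mono_neutral_right) (auto simp: Suc_le_eq)
  then show ?thesis
    using sums_split_initial_segment[OF neg_ln_one_minus_sums[OF assms], of "m + 1"] by simp
qed

text \<open>
  This explains the definition of \<^const>\<open>theta\<close>: it is the remainder of the series of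
  \<open>- ln (1 - b)\<close> after the \<open>m\<close>-th term, divided by \<open>b ^ (m + 1)\<close>, and hence a power series in \<open>b\<close>
  with positive coefficients.
\<close>

lemma theta_sums:
  assumes "0 < b" "b < 1"
  shows "(\<lambda>n. b ^ n / real (n + (m + 1))) sums theta m b"
proof -
  have "(\<lambda>n. b ^ (n + (m + 1)) / real (n + (m + 1)) / b ^ (m + 1)) sums
      ((- ln (1 - b) - (\<Sum>k=1..m. b ^ k / real k)) / b ^ (m + 1))"
    by (intro sums_divide neg_ln_one_minus_tail_sums) (use assms in auto)
  also have "(\<lambda>n. b ^ (n + (m + 1)) / real (n + (m + 1)) / b ^ (m + 1)) = (\<lambda>n. b ^ n / real (n + (m + 1)))"
    using assms by (simp only: power_add[of b _ "m + 1"]) simp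
  also have "(- ln (1 - b) - (\<Sum>k=1..m. b ^ k / real k)) / b ^ (m + 1) = theta m b"
    unfolding theta_def by (simp only: divide_inverse) (simp add: algebra_simps)
  finally show ?thesis .
qed

lemma theta_pos:
  assumes "0 < b" "b < 1"
  shows "theta m b > 0"
proof -
  have "0 < (\<Sum>n. b ^ n / real (n + (m + 1)))"
    by (rule suminf_pos) (use theta_sums[OF assms] assms in \<open>auto simp: sums_iff\<close>)
  then show ?thesis
    using theta_sums[OF assms, of m] by (simp add: sums_iff)
qed

text \<open>
  Termwise comparison of the remainder with the series for \<^const>\<open>theta\<close>:
  \<open>y ^ (n + m + 1) \<le> \<bar>y\<bar> ^ (m + 1) b ^ n\<close>.
\<close>

lemma neg_ln_one_minus_le:
  assumes y: "\<bar>y\<bar> \<le> b" and b: "0 < b" "b < 1"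
  shows "- ln (1 - y) - (\<Sum>k=1..m. y ^ k / real k) \<le> theta m b * \<bar>y\<bar> ^ (m + 1)"
proof (rule sums_le)
  show "(\<lambda>n. y ^ (n + (m + 1)) / real (n + (m + 1))) sums (- ln (1 - y) - (\<Sum>k=1..m. y ^ k / real k))"
    using y b by (intro neg_ln_one_minus_tail_sums) auto
  show "(\<lambda>n. b ^ n / real (n + (m + 1)) * \<bar>y\<bar> ^ (m + 1)) sums (theta m b * \<bar>y\<bar> ^ (m + 1))"
    by (intro sums_mult2 theta_sums b)
  fix n
  have "y ^ (n + (m + 1)) \<le> \<bar>y\<bar> ^ n * \<bar>y\<bar> ^ (m + 1)"
    by (metis abs_ge_self power_abs power_add)
  also have "\<dots> \<le> b ^ n * \<bar>y\<bar> ^ (m + 1)"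
    using y by (intro mult_right_mono power_mono) auto
  finally show "y ^ (n + (m + 1)) / real (n + (m + 1)) \<le> b ^ n / real (n + (m + 1)) * \<bar>y\<bar> ^ (m + 1)"
    by (simp add: divide_right_mono del: of_nat_add power_Suc)
qed

text \<open>
  The estimate for one factor of the moment generating function. The low-order terms are bounded
  by their values at \<open>b\<close>; since the left-hand side vanishes at \<open>y = 0\<close>, only nonzero eigenvalues are
  charged for them, which is how the rank enters. The high-order terms keep their dependence
  on \<open>y\<close> and add up to a power of the Schatten norm.
\<close>

lemma neg_ln_one_minus_minus_le:
  assumes y: "\<bar>y\<bar> \<le> b" and b: "0 < b" "b < 1" and m: "m \<ge> 1"
  shows "- ln (1 - y) - y \<le> (if y = 0 then 0 else \<Sum>k=2..m. b ^ k / real k) + theta m b * \<bar>y\<bar> ^ (m + 1)"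
proof (cases "y = 0")
  case False
  have "(\<Sum>k=1..m. y ^ k / real k) = y + (\<Sum>k=2..m. y ^ k / real k)"
    using m by (simp add: sum.atLeast_Suc_atMost numeral_2_eq_2)
  moreover have "y ^ k \<le> b ^ k" for k
    using power_mono[OF y, of k] by (metis abs_ge_self abs_ge_zero order_trans power_abs)
  then have "(\<Sum>k=2..m. y ^ k / real k) \<le> (\<Sum>k=2..m. b ^ k / real k)"
    by (intro sum_mono divide_right_mono) auto
  ultimately show ?thesis
    using neg_ln_one_minus_le[OF y b, of m] False by simp
qed simp

section \<open>The tail bound\<close>

text \<open>
  Here \<open>W\<close> stands for the \<open>(m + 1)\<close>-th power of the Schatten norm and \<open>L\<close> for the operator norm. The
  unconstrained minimiser of \<open>\<theta> s ^ (m + 1) W - s t\<close> is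
  \<open>s\<^sub>0 = (t / ((m + 1) \<theta> W)) powr (1 / m)\<close>, and the choice is the smaller of \<open>s\<^sub>0\<close> and the largest
  admissible value \<open>b / L\<close>. For every \<open>s \<le> s\<^sub>0\<close> the first term is at most \<open>s t / (m + 1)\<close>, so a
  fraction \<open>m / (m + 1)\<close> of \<open>s t\<close> survives. Finally \<open>s t\<close> is the smaller of \<open>s\<^sub>0 t\<close> and
  \<open>b t / L\<close>, and the minimum of two products of positive numbers is at least the product of the
  minima of their factors.
\<close>

lemma exponent_choice:
  fixes b t W L \<theta> :: real
  assumes m: "m \<ge> 1" and pos: "0 < b" "0 < t" "0 < W" "0 < L" "0 < \<theta>"
  obtains s where "0 < s" "s * L \<le> b"
    "(\<theta> * (s ^ (m + 1) * W) - s * t) / 2 \<le>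
      - (real m / (2 * (real m + 1)) * min (1 / (((real m + 1) * \<theta>) powr (1 / real m))) b *
         min (t powr (1 + 1 / real m) / W powr (1 / real m)) (t / L))"
proof -
  define s0 where "s0 = (t / ((real m + 1) * \<theta> * W)) powr (1 / real m)"
  define s where "s = min s0 (b / L)"
  let ?c = "1 / (((real m + 1) * \<theta>) powr (1 / real m))"
  let ?T = "t powr (1 + 1 / real m) / W powr (1 / real m)"
  have s: "0 < s" "s * L \<le> b"
    using pos by (auto simp: s_def s0_def min_def pos_le_divide_eq)
  have "s ^ m \<le> s0 ^ m"
    using s by (intro power_mono) (auto simp: s_def)
  also have "s0 ^ m = t / ((real m + 1) * \<theta> * W)"
    using pos m by (simp add: s0_def powr_realpow[symmetric] powr_powr)
  finally have "s ^ m * ((real m + 1) * \<theta> * W) \<le> t"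
    using pos by (simp add: pos_le_divide_eq add_pos_nonneg)
  then have "\<theta> * W * s ^ m \<le> t / (real m + 1)"
    by (simp add: pos_le_divide_eq mult_ac)
  then have "s * (\<theta> * W * s ^ m) \<le> s * (t / (real m + 1))"
    using s by (intro mult_left_mono) auto
  moreover have "\<theta> * (s ^ (m + 1) * W) = s * (\<theta> * W * s ^ m)"
    by simp
  ultimately have "(\<theta> * (s ^ (m + 1) * W) - s * t) / 2 \<le> (s * (t / (real m + 1)) - s * t) / 2"
    by (intro divide_right_mono diff_right_mono) (simp_all only:)
  also have "\<dots> = - (real m / (2 * (real m + 1)) * (s * t))"
    by (simp add: divide_simps) (simp add: algebra_simps)
  also have "\<dots> \<le> - (real m / (2 * (real m + 1)) * (min ?c b * min ?T (t / L)))"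
  proof -
    have "s0 * t = ?c * ?T"
      using pos by (simp add: s0_def powr_divide powr_mult powr_add)
    moreover have "min ?c b * min ?T (t / L) \<le> ?c * ?T" "min ?c b * min ?T (t / L) \<le> b * (t / L)"
      using pos by (intro mult_mono; auto)+
    ultimately have "min ?c b * min ?T (t / L) \<le> s * t"
      using pos by (simp add: s_def min_def)
    then show ?thesis
      by (intro le_imp_neg_le mult_left_mono) auto
  qed
  finally show ?thesis
    using that s by (simp add: mult.assoc)
qed

theorem theorem1:
  fixes A :: "real^'n^'n" and M :: "'a measure" and X :: "'a \<Rightarrow> real^'n"
    and m :: nat and b t :: real
  assumes "transpose A = A" and "A \<noteq> 0"
    and "prob_space M" and "std_normal_vec M X"
    and "m \<ge> 1" and "0 < b" and "b < 1" and "t > 0"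
  shows "\<P>(\<omega> in M. X \<omega> \<bullet> (A *v X \<omega>) - trace A > t) \<le> exp (Lambda A m t b)"
proof -
  interpret prob_space M by fact
  obtain Q d where Q: "orthogonal_matrix Q" and A: "A = Q ** diag d ** transpose Q"
    using symmetric_matrix_diagonalizable[OF assms(1)] by blast
  have eigs: "eigenvalues A = image_mset d (mset_set UNIV)"
    unfolding A by (rule eigenvalues_orthogonal_diag[OF Q])
  define L where "L = operator_norm A"
  define W where "W = (\<Sum>i\<in>UNIV. \<bar>d i\<bar> ^ (m + 1))"
  define S where "S = (\<Sum>k=2..m. b ^ k / real k)"
  obtain j where j: "d j \<noteq> 0"
  proof -
    have "diag d \<noteq> 0"
      using assms(2) by (auto simp: A)
    then show ?thesis using that by (auto simp: vec_eq_iff diag_def split: if_splits)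
  qed
  have d_le: "\<bar>d i\<bar> \<le> L" for i
    by (simp add: L_def operator_norm_def eigs image_image)
  have L: "L > 0"
    using d_le[of j] j by linarith
  have W: "W > 0"
    unfolding W_def by (rule sum_pos2[of _ j]) (use j in auto)
  have schatten: "schatten_norm (real m + 1) A powr (1 + 1 / real m) = W powr (1 / real m)"
  proof -
    have "\<bar>x\<bar> powr (real m + 1) = \<bar>x\<bar> ^ (m + 1)" for x :: real
      using powr_realpow'[of "\<bar>x\<bar>" "m + 1"] by (simp add: add.commute)
    then have "(\<Sum>l\<in>#eigenvalues A. \<bar>l\<bar> powr (real m + 1)) = W"
      by (simp add: eigs W_def sum_unfold_sum_mset image_mset.compositionality o_def)
    moreover have "1 / (real m + 1) * (1 + 1 / real m) = 1 / real m"
      using assms(5) by (simp add: field_simps)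
    ultimately show ?thesis
      by (simp only: schatten_norm_def powr_powr)
  qed
  have \<theta>: "theta m b > 0" using assms by (intro theta_pos)
  obtain s where s: "0 < s" "s * L \<le> b" and
    opt: "(theta m b * (s ^ (m + 1) * W) - s * t) / 2 \<le>
      - (kappa m b * min (t powr (1 + 1 / real m) / W powr (1 / real m)) (t / L))"
    using exponent_choice[of m b t W L "theta m b"] assms W L \<theta> unfolding kappa_def by blast
  \<comment> \<open>The constraint on \<open>s\<close> keeps every scaled eigenvalue in the range of the logarithm estimate.\<close>
  have sd: "\<bar>s * d i\<bar> \<le> b" for i
  proof -
    have "\<bar>s * d i\<bar> \<le> s * L" using s(1) d_le[of i] by (simp add: abs_mult)
    then show ?thesis using s(2) by linarith
  qed
  have sd1: "s * d i < 1" for i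
    using sd[of i] assms(7) by linarith
  have "(\<Sum>i\<in>UNIV. - ln (1 - s * d i) - s * d i) \<le>
      (\<Sum>i\<in>UNIV. (if s * d i = 0 then 0 else S) + theta m b * \<bar>s * d i\<bar> ^ (m + 1))"
    unfolding S_def by (intro sum_mono neg_ln_one_minus_minus_le sd assms)
  also have "\<dots> = (\<Sum>i\<in>UNIV. if s * d i = 0 then 0 else S) + theta m b * (s ^ (m + 1) * W)"
    using s(1) by (simp only: sum.distrib W_def sum_distrib_left abs_mult power_mult_distrib abs_of_pos)
  also have "(\<Sum>i\<in>UNIV. if s * d i = 0 then 0 else S) = real (card {i. d i \<noteq> 0}) * S"
    using s(1) by (simp add: sum.If_cases Collect_neg_eq[symmetric])
  also have "\<dots> \<le> real (rank A) * S"
  proof (rule mult_right_mono)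
    show "real (card {i. d i \<noteq> 0}) \<le> real (rank A)"
      unfolding A using card_nonzero_le_rank_orthogonal_diag[OF Q] by simp
    show "0 \<le> S" unfolding S_def using assms by (intro sum_nonneg) simp
  qed
  finally have log_mgf: "(\<Sum>i\<in>UNIV. - ln (1 - s * d i) - s * d i) \<le> real (rank A) * S + theta m b * (s ^ (m + 1) * W)"
    by simp
  \<comment> \<open>Each factor is an exponential, so the estimates of the logarithms can be added up.\<close>
  have factor: "exp (- (s * d i) / 2) / sqrt (1 - s * d i) = exp ((- ln (1 - s * d i) - s * d i) / 2)" for i
  proof -
    have "sqrt (1 - s * d i) = exp (ln (1 - s * d i) / 2)"
      using sd1[of i] by (simp add: exp_ln flip: ln_sqrt)
    then have "exp (- (s * d i) / 2) / sqrt (1 - s * d i) = exp (- (s * d i) / 2 - ln (1 - s * d i) / 2)"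
      by (simp only: exp_diff)
    also have "- (s * d i) / 2 - ln (1 - s * d i) / 2 = (- ln (1 - s * d i) - s * d i) / 2"
      by (simp only: diff_divide_distrib minus_divide_left)
    finally show ?thesis .
  qed
  have X: "distributed M lborel X (\<lambda>x. ennreal (std_normal_vec_density x))"
    using assms(4) by (simp add: std_normal_vec_def)
  have "(*v) A \<in> borel_measurable borel"
    by (intro borel_measurable_continuous_onI linear_continuous_on) (simp add: linear_conv_bounded_linear[symmetric])
  then have h: "(\<lambda>x. x \<bullet> (A *v x) - trace A) \<in> borel_measurable lborel"
    by measurable
  have "emeasure M {\<omega> \<in> space M. X \<omega> \<bullet> (A *v X \<omega>) - trace A > t}
      \<le> ennreal (exp (- (s / 2) * t)) *
        (\<integral>\<^sup>+x. ennreal (std_normal_vec_density x * exp (s / 2 * (x \<bullet> (A *v x) - trace A))) \<partial>lborel)"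
    using s(1) by (intro chernoff_density[OF X _ h]) (simp_all add: std_normal_vec_density_def)
  also have "\<dots> = ennreal (exp (- (s / 2) * t)) * ennreal (\<Prod>i\<in>UNIV. exp ((- ln (1 - s * d i) - s * d i) / 2))"
    by (simp only: gaussian_quadratic_form_mgf[OF Q A sd1] factor)
  also have "\<dots> = ennreal (exp ((\<Sum>i\<in>UNIV. - ln (1 - s * d i) - s * d i) / 2 - s * t / 2))"
    by (simp add: exp_sum[symmetric] ennreal_mult'[symmetric] exp_add[symmetric] sum_divide_distrib)
  also have "\<dots> \<le> ennreal (exp (Lambda A m t b))"
  proof (rule ennreal_leI, subst exp_le_cancel_iff)
    have "(\<Sum>i\<in>UNIV. - ln (1 - s * d i) - s * d i) / 2 - s * t / 2
        \<le> (real (rank A) * S + theta m b * (s ^ (m + 1) * W)) / 2 - s * t / 2"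
      using log_mgf by simp
    also have "\<dots> = real (rank A) / 2 * S + (theta m b * (s ^ (m + 1) * W) - s * t) / 2"
      by (simp add: add_divide_distrib diff_divide_distrib)
    also have "\<dots> \<le> Lambda A m t b"
      unfolding Lambda_def schatten S_def[symmetric] L_def[symmetric] using opt by simp
    finally show "(\<Sum>i\<in>UNIV. - ln (1 - s * d i) - s * d i) / 2 - s * t / 2 \<le> Lambda A m t b" .
  qed
  finally show ?thesis
    by (simp add: emeasure_eq_measure)
qed

end
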